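(* Let $\mathcal{H}$ be a real Hilbert space, and let $K_{1}$ and $K_{2}$ be nonempty closed convex cones in $\mathcal{H}$ such that $K_{1}\cap K_{2}=\{0\}$ and $K_{1}-K_{2}=\mathcal{H}$. Then: (i) $K_{1}$ and $K_{2}$ are linear subspaces of $\mathcal{H}$. (ii) $c_{0}(K_{1},K_{2})=c_{0}(K_{1}^{\oplus},K_{2}^{\ominus})=c_{0}(K_{1}^{\ominus},K_{2}^{\oplus})=c_{0}(K_{1}^{\perp},K_{2}^{\perp})$.
   Context: $\mathcal{H}$ has inner product $\langle\cdot,\cdot\rangle$ and induced norm $\|\cdot\|$; $\mathbf{B}_{\mathcal{H}}$ denotes the closed unit ball. For $S\subseteq\mathcal{H}$, $\overline{\operatorname{cone}}(S)$ is the smallest closed convex cone containing $S$ (so $\overline{\operatorname{cone}}(K)=K$ if $K$ is a nonempty closed convex cone; nonempty closed cones contain $0$). For nonempty convex sets $C,D\subseteq\mathcal{H}$, the cosine of the Dixmier (minimal) angle is $$c_{0}(C,D):=\sup\{\langle x,y\rangle \mid x\in\overline{\operatorname{cone}}(C)\cap\mathbf{B}_{\mathcal{H}},\ y\in\overline{\operatorname{cone}}(D)\cap\mathbf{B}_{\mathcal{H}}\}.$$ For nonempty $C\subseteq\mathcal{H}$, the polar cone is $C^{\ominus}:=\{y\in\mathcal{H}\mid \langle x,y\rangle\leq 0\ \text{for all } x\in C\}$, the dual cone is $C^{\oplus}:=-C^{\ominus}$, and $C^{\perp}$ is the orthogonal complement $\{y\in\mathcal{H}\mid\langle x,y\rangle=0\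 \text{for all }x\in C\}$. Also $K_{1}-K_{2}=\{x-y\mid x\in K_{1},\,y\in K_{2}\}$. *)

theory Defs
  imports "HOL-Analysis.Analysis"
begin

text \<open>
  The predicate \<^const>\<open>convex_cone\<close> asks for nonemptiness and closure under scaling by all
  \<open>c \<ge> 0\<close>. For nonempty closed sets this agrees with the convention that a cone is only
  closed under scaling by \<open>c > 0\<close>, since such sets contain \<open>0\<close>.
\<close>

definition closed_cone_hull :: "'a::real_inner set \<Rightarrow> 'a set" where
  "closed_cone_hull S = (\<lambda>T. closed T \<and> convex_cone T) hull S"

lemma closed_cone_hull_smallest:
  "closed (closed_cone_hull S)" "convex_cone (closed_cone_hull S)" "S \<subseteq> closed_cone_hull S"
  "\<lbrakk>S \<subseteq> T; closed T; convex_cone T\<rbrakk> \<Longrightarrow> closed_cone_hull S \<subseteq> T"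
proof -
  have "closed (closed_cone_hull S) \<and> convex_cone (closed_cone_hull S)"
    unfolding closed_cone_hull_def
    by (rule hull_in) (auto intro: closed_Inter convex_cone_Inter)
  then show "closed (closed_cone_hull S)" "convex_cone (closed_cone_hull S)"
    by auto
  show "S \<subseteq> closed_cone_hull S"
    unfolding closed_cone_hull_def by (rule hull_subset)
  show "closed_cone_hull S \<subseteq> T" if "S \<subseteq> T" "closed T" "convex_cone T"
    unfolding closed_cone_hull_def using that by (simp add: hull_minimal)
qed

text \<open>
  Cosine of the Dixmier angle. The supremum over the reals is a genuine one: the set contains
  \<open>0\<close> and is bounded above by \<open>1\<close>.
\<close>

definition dixmier_cos :: "'a::real_inner set \<Rightarrow> 'a set \<Rightarrow> real" where
  "dixmier_cos C D =
     Sup {x \<bullet> y | x y. x \<in> closed_cone_hull C \<inter> cball 0 1 \<and> y \<in> closed_cone_hull D \<inter> cball 0 1}"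

lemma dixmier_cos_set_wf:
  fixes C D :: "'a::real_inner set"
  defines "A \<equiv> {x \<bullet> y | x y. x \<in> closed_cone_hull C \<inter> cball 0 1 \<and> y \<in> closed_cone_hull D \<inter> cball 0 1}"
  shows "0 \<in> A" "bdd_above A"
proof -
  have "0 \<in> closed_cone_hull C" "0 \<in> closed_cone_hull D"
    by (simp_all add: closed_cone_hull_smallest(2) convex_cone_contains_0)
  then show "0 \<in> A"
    unfolding A_def by (force intro!: exI[of _ 0])
  have "x \<bullet> y \<le> 1" if "norm x \<le> 1" "norm y \<le> 1" for x y :: 'a
    using norm_cauchy_schwarz[of x y] mult_mono[OF that] by simp
  then show "bdd_above A"
    unfolding A_def by (intro bdd_aboveI[of _ 1]) auto
qed

definition polar_cone :: "'a::real_inner set \<Rightarrow> 'a set" where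
  "polar_cone C = {y. \<forall>x\<in>C. x \<bullet> y \<le> 0}"

definition dual_cone :: "'a::real_inner set \<Rightarrow> 'a set" where
  "dual_cone C = uminus ` polar_cone C"

end

theory Submission
  imports Defs
begin

text \<open>
  \<^emph>\<open>Subspaces.\<close> If \<open>x \<in> K1\<close> and \<open>- x = a - b\<close> with \<open>a \<in> K1\<close>, \<open>b \<in> K2\<close>, then \<open>b = a + x\<close> lies
  in both cones, so \<open>b = 0\<close> and \<open>- x = a \<in> K1\<close>; similarly for \<open>K2\<close>. A convex cone closed under negation is
  a subspace, and the polar and dual cones of a subspace are both its orthogonal complement. Hence
  all of (ii) reduces to the equality of the angles of \<open>(M, N)\<close> and \<open>(M\<^sup>\<bottom>, N\<^sup>\<bottom>)\<close> for closed
  subspaces \<open>M\<close>, \<open>N\<close> with \<open>M \<inter> N = {0}\<close> and \<open>M + N\<close> the whole space.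

  \<^emph>\<open>Equality of the angles.\<close> Let \<open>c\<close> and \<open>d\<close> be the cosines for \<open>(M, N)\<close> and \<open>(M\<^sup>\<bottom>, N\<^sup>\<bottom>)\<close>.
  The inequality \<open>d \<le> c\<close> rests on \<open>M + N\<close> being everything: a vector \<open>v \<in> N\<^sup>\<bottom>\<close> split as
  \<open>m + n\<close> satisfies \<open>|v|\<^sup>2 = |m|\<^sup>2 - |n|\<^sup>2\<close> and \<open>|n| \<le> c |m|\<close>, which forces \<open>v\<close> to lie within
  \<open>c |v|\<close> of the line through \<open>m\<close>, and so of \<open>M\<close> (lemma \<open>inner_bound_orthogonal_comp\<close>).
  The inequality \<open>c \<le> d\<close> is the same statement for the pair \<open>(M\<^sup>\<bottom>, N\<^sup>\<bottom>)\<close>, because \<open>M\<^sup>\<bottom>\<^sup>\<bottom> = M\<close>, once \<open>M\<^sup>\<bottom> + N\<^sup>\<bottom>\<close> is known to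
  be the whole space. If \<open>d \<ge> 1\<close> there is nothing to show since \<open>c \<le> 1\<close>. If \<open>d < 1\<close>, the
  positive angle makes \<open>M\<^sup>\<bottom> + N\<^sup>\<bottom>\<close> closed (lemma \<open>closed_sum_of_angle\<close>), and its orthogonal
  complement is \<open>M \<inter> N = {0}\<close>, so it is the whole space (lemma \<open>sum_orthogonal_comp_eq_UNIV\<close>).
  Completeness enters through the projection theorem, which gives \<open>M\<^sup>\<bottom>\<^sup>\<bottom> = M\<close>, and through the
  closedness of the sum.
\<close>

section \<open>Orthogonal projection onto a closed subspace\<close>

lemma mem_orthogonal_comp: "y \<in> orthogonal_comp S \<longleftrightarrow> (\<forall>x\<in>S. x \<bullet> y = 0)"
  by (simp add: orthogonal_comp_def orthogonal_def)

lemma closed_orthogonal_comp: "closed (orthogonal_comp (S :: 'a::real_inner set))"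
proof -
  have "orthogonal_comp S = (\<Inter>x\<in>S. {y. x \<bullet> y = 0})"
    by (auto simp: mem_orthogonal_comp)
  then show ?thesis
    by (auto intro!: closed_INT closed_Collect_eq continuous_intros)
qed

text \<open>
  Points of \<open>C\<close> that almost realise the distance \<open>\<delta>\<close> from \<open>x\<close> are close to one another: their midpoint is
  again in \<open>C\<close>, hence at distance at least \<open>\<delta>\<close>, and the parallelogram law bounds
  their distance. So the sets of near-minimisers shrink to a point by completeness.
\<close>

lemma nearest_point_exists:
  fixes C :: "'a::{real_inner, banach} set"
  assumes "closed C" "convex C" "C \<noteq> {}"
  obtains a where "a \<in> C" "\<And>y. y \<in> C \<Longrightarrow> norm (x - a) \<le> norm (x - y)"
proof -
  define \<delta> where "\<delta> = infdist x C"
  define S where "S n = {y \<in> C. dist x y \<le> \<delta> + inverse (real (Suc n))}" for n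
  have \<delta>_le: "\<delta> \<le> norm (x - y)" if "y \<in> C" for y
    unfolding \<delta>_def using infdist_le[OF that, of x] by (simp add: dist_norm)
  have \<delta>_nonneg: "0 \<le> \<delta>"
    by (simp add: \<delta>_def infdist_nonneg)
  have diam: "(dist y z)\<^sup>2 \<le> 4 * ((\<delta> + inverse (real (Suc n)))\<^sup>2 - \<delta>\<^sup>2)"
    if "y \<in> S n" "z \<in> S n" for y z n
  proof -
    have "(1/2) *\<^sub>R y + (1/2) *\<^sub>R z \<in> C"
      using that assms(2) by (intro convexD) (auto simp: S_def)
    from \<delta>_le[OF this] have mid: "\<delta>\<^sup>2 \<le> (norm (x - ((1/2) *\<^sub>R y + (1/2) *\<^sub>R z)))\<^sup>2"
      using \<delta>_nonneg by (intro power_mono)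
    have "(norm (x - y))\<^sup>2 \<le> (\<delta> + inverse (real (Suc n)))\<^sup>2"
      and "(norm (x - z))\<^sup>2 \<le> (\<delta> + inverse (real (Suc n)))\<^sup>2"
      using that by (auto simp: S_def dist_norm intro!: power_mono)
    moreover have "(norm (y - z))\<^sup>2 = 2 * (norm (x - y))\<^sup>2 + 2 * (norm (x - z))\<^sup>2
        - 4 * (norm (x - ((1/2) *\<^sub>R y + (1/2) *\<^sub>R z)))\<^sup>2"
      unfolding power2_norm_eq_inner by (simp add: inner_simps inner_commute algebra_simps)
    ultimately show ?thesis
      using mid by (simp add: dist_norm)
  qed
  obtain a where a: "\<And>n. a \<in> S n"
  proof (rule decreasing_closed_nest[of S])
    show "closed (S n)" for n
    proof -
      have "S n = C \<inter> cball x (\<delta> + inverse (real (Suc n)))"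
        by (auto simp: S_def)
      then show ?thesis using assms(1) by auto
    qed
    show "S n \<noteq> {}" for n
    proof -
      have "infdist x C < \<delta> + inverse (real (Suc n))"
        by (simp add: \<delta>_def)
      then obtain y where "y \<in> C" "dist x y < \<delta> + inverse (real (Suc n))"
        using assms(3) by (auto simp: infdist_notempty cINF_less_iff)
      then show ?thesis by (force simp: S_def)
    qed
    show "S n \<subseteq> S m" if "m \<le> n" for m n
    proof -
      have "inverse (real (Suc n)) \<le> inverse (real (Suc m))"
        using that by simp
      then show ?thesis unfolding S_def by (auto simp del: of_nat_Suc inverse_le_iff_le)
    qed
    show "\<exists>n. \<forall>y\<in>S n. \<forall>z\<in>S n. dist y z < \<epsilon>" if "\<epsilon> > 0" for \<epsilon>
    proof -
      have "(\<lambda>n. 4 * ((\<delta> + inverse (real (Suc n)))\<^sup>2 - \<delta>\<^sup>2)) \<longlonglongrightarrow> 4 * ((\<delta> + 0)\<^sup>2 - \<delta>\<^sup>2)"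
        by (intro tendsto_intros LIMSEQ_inverse_real_of_nat)
      then have "\<forall>\<^sub>F n in sequentially. 4 * ((\<delta> + inverse (real (Suc n)))\<^sup>2 - \<delta>\<^sup>2) < \<epsilon>\<^sup>2"
        by (rule order_tendstoD) (use that in simp)
      then obtain n where "4 * ((\<delta> + inverse (real (Suc n)))\<^sup>2 - \<delta>\<^sup>2) < \<epsilon>\<^sup>2"
        by (auto simp: eventually_sequentially)
      then show ?thesis
        using diam[of _ n] that by (meson le_less_trans less_imp_le power_less_imp_less_base)
    qed
  qed auto
  have "(\<lambda>n. \<delta> + inverse (real (Suc n))) \<longlonglongrightarrow> \<delta> + 0"
    by (intro tendsto_intros LIMSEQ_inverse_real_of_nat)
  moreover have "\<exists>N. \<forall>n\<ge>N. dist x a \<le> \<delta> + inverse (real (Suc n))"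
    using a unfolding S_def by blast
  ultimately have "dist x a \<le> \<delta>"
    using LIMSEQ_le_const by fastforce
  then show thesis
    using a[of 0] \<delta>_le by (intro that[of a]) (force simp: S_def dist_norm)+
qed

text \<open>
  Take \<open>p\<close> nearest to \<open>x\<close> in \<open>M\<close>: if \<open>x - p\<close> had a component along some \<open>m \<in> M\<close>, subtracting it
  would give a nearer point.
\<close>

lemma orthogonal_decomposition:
  fixes M :: "'a::{real_inner, banach} set"
  assumes "closed M" "subspace M"
  obtains p where "p \<in> M" "x - p \<in> orthogonal_comp M"
proof -
  obtain p where p: "p \<in> M" "\<And>y. y \<in> M \<Longrightarrow> norm (x - p) \<le> norm (x - y)"
    using nearest_point_exists[of M x] assms subspace_imp_convex subspace_0 by blast
  have "m \<bullet> (x - p) = 0" if m: "m \<in> M" for m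
  proof (rule ccontr)
    assume ne: "m \<bullet> (x - p) \<noteq> 0"
    define t where "t = (m \<bullet> (x - p)) / (m \<bullet> m)"
    have mm: "m \<bullet> m > 0" using ne by auto
    have "p + t *\<^sub>R m \<in> M"
      using p(1) m assms(2) by (simp add: subspace_add subspace_scale)
    then have "(norm (x - p))\<^sup>2 \<le> (norm (x - (p + t *\<^sub>R m)))\<^sup>2"
      by (intro power_mono p(2)) auto
    also have "\<dots> = (norm (x - p))\<^sup>2 - 2 * t * (m \<bullet> (x - p)) + t * t * (m \<bullet> m)"
      unfolding power2_norm_eq_inner by (simp add: inner_simps inner_commute algebra_simps)
    also have "\<dots> = (norm (x - p))\<^sup>2 - (m \<bullet> (x - p))\<^sup>2 / (m \<bullet> m)"
      using mm by (simp add: t_def field_simps power2_eq_square)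
    finally show False
      using ne mm by (simp add: field_simps)
  qed
  then show thesis
    using p(1) that[of p] by (simp add: mem_orthogonal_comp)
qed

lemma orthogonal_comp_orthogonal_comp:
  fixes M :: "'a::{real_inner, banach} set"
  assumes "closed M" "subspace M"
  shows "orthogonal_comp (orthogonal_comp M) = M"
proof
  show "M \<subseteq> orthogonal_comp (orthogonal_comp M)"
    by (rule orthogonal_comp_subset)
  show "orthogonal_comp (orthogonal_comp M) \<subseteq> M"
  proof
    fix x assume x: "x \<in> orthogonal_comp (orthogonal_comp M)"
    obtain p where p: "p \<in> M" "x - p \<in> orthogonal_comp M"
      using orthogonal_decomposition[OF assms] .
    have "(x - p) \<bullet> x = 0" "(x - p) \<bullet> p = 0"
      using x p by (auto simp: mem_orthogonal_comp inner_commute)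
    then have "(x - p) \<bullet> (x - p) = 0"
      by (simp add: inner_diff_right)
    then show "x \<in> M" using p(1) by simp
  qed
qed

section \<open>Angle bounds and orthogonal complements\<close>

text \<open>
  Since \<open>u\<close> is orthogonal to \<open>M\<close>, the product \<open>u \<bullet> v\<close> does not change when a multiple of \<open>m\<close> is
  subtracted from \<open>v\<close>. So it suffices that the component \<open>w\<close> of \<open>v\<close> orthogonal to \<open>m\<close> has norm at most
  \<open>c |v|\<close>, and Pythagoras gives \<open>|w|\<^sup>2 = |v|\<^sup>2 |n|\<^sup>2 / |m|\<^sup>2\<close>. The angle bound is applied to
  \<open>- m\<close> and \<open>n\<close>, for which \<open>(- m) \<bullet> n = |n|\<^sup>2\<close> because \<open>v\<close> is orthogonal to \<open>n\<close>.
\<close>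

lemma inner_bound_orthogonal_comp:
  fixes M N :: "'a::real_inner set"
  assumes "subspace M" "subspace N"
    and bound: "\<And>m n. m \<in> M \<Longrightarrow> n \<in> N \<Longrightarrow> m \<bullet> n \<le> c * norm m * norm n"
    and "0 \<le> c"
    and u: "u \<in> orthogonal_comp M" and v: "v \<in> orthogonal_comp N"
    and v_dec: "v = m + n" "m \<in> M" "n \<in> N"
  shows "u \<bullet> v \<le> c * norm u * norm v"
proof (cases "v = 0")
  case False
  have um: "u \<bullet> m = 0" and nv: "n \<bullet> v = 0"
    using u v v_dec by (auto simp: mem_orthogonal_comp inner_commute)
  have vm: "v \<bullet> m = v \<bullet> v"
    using nv v_dec(1) by (metis add.right_neutral inner_add_right inner_commute)
  then have m_pos: "m \<bullet> m > 0"
    using False by auto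
  have nn: "n \<bullet> n = (- m) \<bullet> n" and mm: "m \<bullet> m = v \<bullet> v + n \<bullet> n"
    using nv vm v_dec(1) by (auto simp: inner_simps inner_commute)
  have "(norm n)\<^sup>2 \<le> c * norm m * norm n"
    using bound[of "- m" n] v_dec assms(1) nn by (simp add: subspace_neg power2_norm_eq_inner)
  then have "norm n \<le> c * norm m"
    by (cases "n = 0") (use \<open>0 \<le> c\<close> in \<open>auto simp: power2_eq_square\<close>)
  then have "(norm n)\<^sup>2 \<le> (c * norm m)\<^sup>2"
    by (intro power_mono) auto
  then have nle: "n \<bullet> n \<le> c\<^sup>2 * (m \<bullet> m)"
    by (simp add: power2_norm_eq_inner power_mult_distrib)
  \<comment> \<open>As \<open>v \<bullet> m = v \<bullet> v\<close>, the vector \<open>t *\<^sub>R m\<close> is the projection of \<open>v\<close> onto the line through \<open>m\<close>.\<close>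
  define t where "t = (v \<bullet> v) / (m \<bullet> m)"
  define w where "w = v - t *\<^sub>R m"
  have "w \<bullet> w = v \<bullet> v - 2 * t * (v \<bullet> v) + t * t * (m \<bullet> m)"
    unfolding w_def using vm by (simp add: inner_simps inner_commute algebra_simps)
  also have "\<dots> = (v \<bullet> v) * (n \<bullet> n) / (m \<bullet> m)"
  proof -
    have "t * (m \<bullet> m) = v \<bullet> v"
      using m_pos by (simp add: t_def)
    then have "v \<bullet> v - 2 * t * (v \<bullet> v) + t * t * (m \<bullet> m) = v \<bullet> v - t * (v \<bullet> v)"
      by (simp add: mult.assoc)
    also have "\<dots> = (v \<bullet> v) * (m \<bullet> m - v \<bullet> v) / (m \<bullet> m)"
      using m_pos by (simp add: t_def field_simps)
    finally show ?thesis
      using mm by simp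
  qed
  also have "\<dots> \<le> (v \<bullet> v) * c\<^sup>2"
    using m_pos nle mult_left_mono[OF nle, of "v \<bullet> v"] by (simp add: field_simps)
  finally have "(norm w)\<^sup>2 \<le> (c * norm v)\<^sup>2"
    by (simp add: power2_norm_eq_inner power_mult_distrib mult.commute)
  then have "norm w \<le> c * norm v"
    using \<open>0 \<le> c\<close> by (auto intro: power2_le_imp_le)
  have "u \<bullet> v = u \<bullet> w"
    using um by (simp add: w_def inner_simps)
  also have "\<dots> \<le> norm u * norm w"
    by (rule norm_cauchy_schwarz)
  also have "\<dots> \<le> norm u * (c * norm v)"
    by (intro mult_left_mono \<open>norm w \<le> c * norm v\<close>) auto
  finally show ?thesis by (simp add: mult_ac)
qed simp

text \<open>
  The bound on the angle makes addition bounded below on \<open>A \<times> B\<close>, namely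
  \<open>(1 - d) (|a|\<^sup>2 + |b|\<^sup>2) \<le> |a + b|\<^sup>2\<close> when \<open>d \<ge> 0\<close>, and the image of a complete subspace under a
  bounded linear map that is bounded below is complete.
\<close>

lemma closed_sum_of_angle:
  fixes A B :: "'a::{real_inner, banach} set"
  assumes "closed A" "subspace A" "closed B" "subspace B" and "d < 1"
    and bound: "\<And>a b. a \<in> A \<Longrightarrow> b \<in> B \<Longrightarrow> a \<bullet> b \<le> d * norm a * norm b"
  shows "closed {a + b |a b. a \<in> A \<and> b \<in> B}"
proof -
  \<comment> \<open>A negative \<open>d\<close> is replaced by \<open>0\<close>, which keeps \<open>1 - e \<ge> 0\<close>.\<close>
  define e where "e = 1 - max d 0"
  have e: "0 < e" "e \<le> 1" using \<open>d < 1\<close> by (auto simp: e_def)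
  have lower: "sqrt e * norm z \<le> norm (fst z + snd z)" if "z \<in> A \<times> B" for z
  proof (rule power2_le_imp_le)
    obtain a b where z: "z = (a, b)" "a \<in> A" "b \<in> B" using \<open>z \<in> A \<times> B\<close> by auto
    have "(- a) \<bullet> b \<le> d * norm a * norm b"
      using bound[of "- a" b] z assms(2) by (simp add: subspace_neg)
    also have "\<dots> \<le> (1 - e) * (norm a * norm b)"
      by (simp add: e_def mult_right_mono mult.assoc)
    finally have "- (a \<bullet> b) \<le> (1 - e) * (norm a * norm b)" by simp
    moreover have "(1 - e) * (2 * (norm a * norm b)) \<le> (1 - e) * ((norm a)\<^sup>2 + (norm b)\<^sup>2)"
      using e sum_squares_bound[of "norm a" "norm b"] by (intro mult_left_mono) auto
    ultimately have "e * ((norm a)\<^sup>2 + (norm b)\<^sup>2) \<le> (norm a)\<^sup>2 + (norm b)\<^sup>2 + 2 * (a \<bullet> b)"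
      by (simp add: algebra_simps)
    also have "\<dots> = (norm (a + b))\<^sup>2"
      by (simp add: dot_norm field_simps)
    finally show "(sqrt e * norm z)\<^sup>2 \<le> (norm (fst z + snd z))\<^sup>2"
      using e by (simp add: z norm_Pair power_mult_distrib)
  qed simp
  have "complete ((\<lambda>z. fst z + snd z) ` (A \<times> B))"
  proof (rule complete_isometric_image)
    show "0 < sqrt e" using e by simp
    show "subspace (A \<times> B)" using assms by (intro subspace_Times)
    show "bounded_linear (\<lambda>z::'a \<times> 'a. fst z + snd z)"
      by (intro bounded_linear_add bounded_linear_fst bounded_linear_snd)
    show "\<forall>z\<in>A \<times> B. sqrt e * norm z \<le> norm (fst z + snd z)" using lower by blast
    show "complete (A \<times> B)" using assms by (simp add: complete_eq_closed closed_Times)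
  qed
  moreover have "(\<lambda>z. fst z + snd z) ` (A \<times> B) = {a + b |a b. a \<in> A \<and> b \<in> B}"
    by force
  ultimately show ?thesis by (simp add: complete_eq_closed)
qed

text \<open>
  A vector orthogonal to \<open>M\<^sup>\<bottom> + N\<^sup>\<bottom>\<close> lies in \<open>M\<^sup>\<bottom>\<^sup>\<bottom> \<inter> N\<^sup>\<bottom>\<^sup>\<bottom> = M \<inter> N\<close>, so the sum is
  dense; the strict bound on the angle is what makes it closed.
\<close>

lemma sum_orthogonal_comp_eq_UNIV:
  fixes M N :: "'a::{real_inner, banach} set"
  assumes M: "closed M" "subspace M" and N: "closed N" "subspace N" and "M \<inter> N = {0}" and "d < 1"
    and bound: "\<And>u v. u \<in> orthogonal_comp M \<Longrightarrow> v \<in> orthogonal_comp N \<Longrightarrow> u \<bullet> v \<le> d * norm u * norm v"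
  shows "{u + v |u v. u \<in> orthogonal_comp M \<and> v \<in> orthogonal_comp N} = UNIV" (is "?R = _")
proof -
  have sub: "subspace ?R"
    by (intro subspace_sums subspace_orthogonal_comp)
  have "closed ?R"
    by (rule closed_sum_of_angle[OF closed_orthogonal_comp subspace_orthogonal_comp
          closed_orthogonal_comp subspace_orthogonal_comp \<open>d < 1\<close> bound])
  have "orthogonal_comp M \<subseteq> ?R" "orthogonal_comp N \<subseteq> ?R"
    using subspace_0[OF subspace_orthogonal_comp] by force+
  then have "orthogonal_comp ?R \<subseteq> M \<inter> N"
    using orthogonal_comp_anti_mono orthogonal_comp_orthogonal_comp M N by blast
  then have "orthogonal_comp ?R = {0}"
    using \<open>M \<inter> N = {0}\<close> subspace_0[OF subspace_orthogonal_comp] by blast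
  then show ?thesis
    using orthogonal_comp_orthogonal_comp[OF \<open>closed ?R\<close> sub] by simp
qed

section \<open>The Dixmier angle of closed subspaces\<close>

lemma closed_cone_hull_subspace:
  assumes "closed M" "subspace M"
  shows "closed_cone_hull M = M"
  using closed_cone_hull_smallest(3)[of M] closed_cone_hull_smallest(4)[of M M] assms
  by (auto simp: subspace_imp_convex_cone)

lemma dixmier_cos_nonneg: "0 \<le> dixmier_cos C D"
  unfolding dixmier_cos_def using dixmier_cos_set_wf[of C D] by (rule cSup_upper)

text \<open>
  For closed subspaces the supremum over unit balls is the best constant in a strengthened
  Cauchy-Schwarz inequality: the next lemma says that it is such a constant, and
  \<open>dixmier_cos_least\<close> that no smaller nonnegative one works.
\<close>

lemma inner_le_dixmier_cos:
  assumes M: "closed M" "subspace M" and N: "closed N" "subspace N"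
    and m: "m \<in> M" and n: "n \<in> N"
  shows "m \<bullet> n \<le> dixmier_cos M N * norm m * norm n"
proof (cases "m = 0 \<or> n = 0")
  case False
  have "sgn m \<in> M" "sgn n \<in> N"
    using assms by (auto simp: sgn_div_norm subspace_scale)
  moreover have "norm (sgn m) \<le> 1" "norm (sgn n) \<le> 1"
    by (auto simp: norm_sgn)
  ultimately have "sgn m \<bullet> sgn n \<le> dixmier_cos M N"
    unfolding dixmier_cos_def using dixmier_cos_set_wf(2)[of M N]
    by (intro cSup_upper) (auto simp: closed_cone_hull_subspace M N)
  then show ?thesis
    using False by (simp add: sgn_div_norm field_simps)
qed auto

lemma dixmier_cos_least:
  assumes M: "closed M" "subspace M" and N: "closed N" "subspace N" and "0 \<le> c"
    and bound: "\<And>m n. m \<in> M \<Longrightarrow> n \<in> N \<Longrightarrow> m \<bullet> n \<le> c * norm m * norm n"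
  shows "dixmier_cos M N \<le> c"
  unfolding dixmier_cos_def
proof (rule cSup_least)
  fix r assume "r \<in> {x \<bullet> y |x y. x \<in> closed_cone_hull M \<inter> cball 0 1 \<and> y \<in> closed_cone_hull N \<inter> cball 0 1}"
  then obtain x y where r: "r = x \<bullet> y" and xy: "x \<in> M" "y \<in> N" "norm x \<le> 1" "norm y \<le> 1"
    by (auto simp: closed_cone_hull_subspace M N)
  have "r \<le> c * (norm x * norm y)"
    using bound[OF xy(1,2)] r by (simp add: mult.assoc)
  also have "\<dots> \<le> c * 1"
    using xy \<open>0 \<le> c\<close> by (intro mult_left_mono mult_le_one) auto
  finally show "r \<le> c" by simp
qed (use dixmier_cos_set_wf(1) in blast)

lemma dixmier_cos_orthogonal_comp_le:
  fixes M N :: "'a::{real_inner, banach} set"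
  assumes M: "closed M" "subspace M" and N: "closed N" "subspace N"
    and sum: "{m + n |m n. m \<in> M \<and> n \<in> N} = UNIV"
  shows "dixmier_cos (orthogonal_comp M) (orthogonal_comp N) \<le> dixmier_cos M N"
proof (rule dixmier_cos_least[OF closed_orthogonal_comp subspace_orthogonal_comp
      closed_orthogonal_comp subspace_orthogonal_comp dixmier_cos_nonneg])
  fix u v assume uv: "u \<in> orthogonal_comp M" "v \<in> orthogonal_comp N"
  obtain m n where "v = m + n" "m \<in> M" "n \<in> N"
    using sum by blast
  then show "u \<bullet> v \<le> dixmier_cos M N * norm u * norm v"
    using inner_bound_orthogonal_comp[OF M(2) N(2) inner_le_dixmier_cos[OF M N] dixmier_cos_nonneg uv]
    by blast
qed

text \<open>
  The preceding inequality is applied to \<open>(M, N)\<close> and to \<open>(M\<^sup>\<bottom>, N\<^sup>\<bottom>)\<close>. The second application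
  needs the complements to span, which is guaranteed when their angle is positive; when it is zero,
  the trivial bound \<open>dixmier_cos M N \<le> 1\<close> already suffices.
\<close>

lemma dixmier_cos_orthogonal_comp:
  fixes M N :: "'a::{real_inner, banach} set"
  assumes M: "closed M" "subspace M" and N: "closed N" "subspace N"
    and "M \<inter> N = {0}" and sum: "{m + n |m n. m \<in> M \<and> n \<in> N} = UNIV"
  shows "dixmier_cos (orthogonal_comp M) (orthogonal_comp N) = dixmier_cos M N"
proof (rule antisym)
  let ?d = "dixmier_cos (orthogonal_comp M) (orthogonal_comp N)"
  show "?d \<le> dixmier_cos M N"
    using dixmier_cos_orthogonal_comp_le[OF M N sum] .
  note perps = closed_orthogonal_comp[of M] subspace_orthogonal_comp[of M]
    closed_orthogonal_comp[of N] subspace_orthogonal_comp[of N]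
  show "dixmier_cos M N \<le> ?d"
  proof (cases "?d < 1")
    case True
    have "{u + v |u v. u \<in> orthogonal_comp M \<and> v \<in> orthogonal_comp N} = UNIV"
      using sum_orthogonal_comp_eq_UNIV[OF M N \<open>M \<inter> N = {0}\<close> True inner_le_dixmier_cos[OF perps]] .
    from dixmier_cos_orthogonal_comp_le[OF perps this] show ?thesis
      by (simp add: orthogonal_comp_orthogonal_comp M N)
  next
    case False
    have "dixmier_cos M N \<le> 1"
      using norm_cauchy_schwarz by (intro dixmier_cos_least M N) auto
    then show ?thesis using False by simp
  qed
qed

section \<open>Complementary convex cones\<close>

text \<open>
  Writing \<open>- x\<close> (for \<open>x \<in> K1\<close>), respectively \<open>y\<close> (for \<open>y \<in> K2\<close>), as a difference \<open>a - b\<close> puts \<open>b\<close>,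
  respectively \<open>a\<close>, into the intersection of the cones. Hence it vanishes.
\<close>

lemma complementary_convex_cone_subspace:
  assumes "convex_cone K1" "convex_cone K2" "K1 \<inter> K2 = {0}" "{x - y |x y. x \<in> K1 \<and> y \<in> K2} = UNIV"
  shows "subspace K1" "subspace K2"
proof -
  have neg1: "- x \<in> K1" if "x \<in> K1" for x
  proof -
    obtain a b where ab: "- x = a - b" "a \<in> K1" "b \<in> K2"
      using assms(4) by blast
    then have "b = a + x" by (simp add: algebra_simps)
    then have "b \<in> K1 \<inter> K2"
      using ab that assms(1) by (simp add: convex_cone_add)
    then show ?thesis using ab assms(3) by simp
  qed
  have neg2: "- y \<in> K2" if "y \<in> K2" for y
  proof -
    obtain a b where ab: "y = a - b" "a \<in> K1" "b \<in> K2"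
      using assms(4) by blast
    then have "a = y + b" by (simp add: algebra_simps)
    then have "a \<in> K1 \<inter> K2"
      using ab(2,3) that assms(2) by (simp add: convex_cone_add)
    then show ?thesis using ab assms(3) by simp
  qed
  have "subspace K" if K: "convex_cone K" "\<And>x. x \<in> K \<Longrightarrow> - x \<in> K" for K :: "'a set"
  proof (rule subspaceI)
    show "c *\<^sub>R x \<in> K" if "x \<in> K" for c x
    proof (cases "0 \<le> c")
      case False
      then have "(- c) *\<^sub>R (- x) \<in> K"
        using K that by (intro convex_cone_scaleR) auto
      then show ?thesis by simp
    qed (use K that in \<open>auto intro: convex_cone_scaleR\<close>)
  qed (use K in \<open>auto intro: convex_cone_add convex_cone_contains_0\<close>)
  then show "subspace K1" "subspace K2"
    using assms(1,2) neg1 neg2 by auto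
qed

lemma polar_cone_subspace:
  assumes "subspace M"
  shows "polar_cone M = orthogonal_comp M"
proof -
  have "x \<bullet> y = 0" if "\<forall>x\<in>M. x \<bullet> y \<le> 0" "x \<in> M" for x y
    using that(1)[rule_format, OF that(2)] that(1)[rule_format, of "- x"] that(2) assms
    by (simp add: subspace_neg)
  then show ?thesis
    by (auto simp: polar_cone_def mem_orthogonal_comp)
qed

lemma dual_cone_subspace:
  assumes "subspace M"
  shows "dual_cone M = orthogonal_comp M"
  unfolding dual_cone_def polar_cone_subspace[OF assms]
  using subspace_neg[OF subspace_orthogonal_comp[of M]]
  by (auto simp: image_iff) (metis minus_minus)

theorem theorem4p1:
  fixes K1 K2 :: "'a::{real_inner, banach} set"
  assumes "closed K1" and "convex_cone K1"
    and "closed K2" and "convex_cone K2"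
    and "K1 \<inter> K2 = {0}"
    and "{x - y | x y. x \<in> K1 \<and> y \<in> K2} = UNIV"
  shows "(subspace K1 \<and> subspace K2) \<and>
    (dixmier_cos K1 K2 = dixmier_cos (dual_cone K1) (polar_cone K2) \<and>
     dixmier_cos (dual_cone K1) (polar_cone K2) = dixmier_cos (polar_cone K1) (dual_cone K2) \<and>
     dixmier_cos (polar_cone K1) (dual_cone K2) = dixmier_cos (orthogonal_comp K1) (orthogonal_comp K2))"
proof -
  note sub = complementary_convex_cone_subspace[OF assms(2,4-6)]
  have "x \<in> {m + n |m n. m \<in> K1 \<and> n \<in> K2}" for x
  proof -
    obtain a b where "x = a - b" "a \<in> K1" "b \<in> K2"
      using assms(6) by blast
    then show ?thesis
      using subspace_neg[OF sub(2)] by (metis (mono_tags, lifting) diff_conv_add_uminus mem_Collect_eq)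
  qed
  then have "{m + n |m n. m \<in> K1 \<and> n \<in> K2} = UNIV" by blast
  then show ?thesis
    using dixmier_cos_orthogonal_comp[OF assms(1) sub(1) assms(3) sub(2) assms(5)] sub
    by (simp add: polar_cone_subspace dual_cone_subspace)
qed

end
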